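(* Let $\varepsilon>0$, let $f$ be continuous on $[0,1]$, and let $u$ be the exact solution of $-\varepsilon u''(x)+u'(x)=f(x)$ for $0<x<1$, $u(0)=u(1)=0$. Let $n\ge 2$, $h=1/n$, $x_j=jh$ for $j=0,1,\dots,n$, and let $u_h=\sum_{i=1}^{n-1}u_i\varphi_i\in\mathcal{M}_h$ be the finite element solution of the upwinding Petrov-Galerkin discretization with exponential bubble test space $V_h$, that is, $$\varepsilon\int_0^1 u_h'v_h'\,dx+\int_0^1 u_h'v_h\,dx=\int_0^1 f v_h\,dx\quad\text{for all } v_h\in V_h.$$ Then $u_h$ coincides with the continuous piecewise linear interpolant $I_h(u)$ of $u$ on the nodes $x_0,x_1,\dots,x_n$; in other words, $u_j=u(x_j)$ for $j=1,2,\dots,n-1$.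
   Context: For $j=1,\dots,n-1$, $\varphi_j$ is the nodal hat function: continuous on $[0,1]$, linear on each $[x_{i-1},x_i]$, with $\varphi_j(x_i)=\delta_{ij}$ for $i=0,\dots,n$. The trial space is $\mathcal{M}_h=\mathrm{span}\{\varphi_j\}_{j=1}^{n-1}$. The exponential bubble $B:[0,h]\to\mathbb{R}$ is the unique solution of $-\varepsilon B''-B'=1/h$ on $(0,h)$ with $B(0)=B(h)=0$. For $i=1,\dots,n$, $B_i:[0,1]\to\mathbb{R}$ is defined by $B_i(x)=B(x-x_{i-1})$ for $x\in[x_{i-1},x_i]$ and $B_i(x)=0$ otherwise. The test space is $V_h=\mathrm{span}\{g_j\}_{j=1}^{n-1}$, where $g_j=\varphi_j+B_j-B_{j+1}$. The interpolant $I_h(u)$ is the continuous function that is linear on each $[x_{i-1},x_i]$ and equals $u$ at every node $x_0,\dots,x_n$. *)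

theory Defs
  imports "HOL-Analysis.Analysis"
begin

definition mesh_width :: "nat \<Rightarrow> real" where
  "mesh_width n = 1 / real n"

definition node :: "nat \<Rightarrow> nat \<Rightarrow> real" where
  "node n j = real j * mesh_width n"

text \<open>
  Classical solution of \<open>-\<epsilon> w'' + b w' = f\<close> on \<open>(0, L)\<close> with \<open>w(0) = w(L) = 0\<close>; the boundary
  values are attained continuously. The exact solution has \<open>b = 1\<close>, the bubble \<open>b = -1\<close>.
  Only the restriction of \<open>w\<close> to \<open>[0, L]\<close> matters.
\<close>

definition bvp_solution ::
    "real \<Rightarrow> real \<Rightarrow> (real \<Rightarrow> real) \<Rightarrow> real \<Rightarrow> (real \<Rightarrow> real) \<Rightarrow> bool" where
  "bvp_solution \<epsilon> b f L w \<longleftrightarrow>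
     continuous_on {0..L} w \<and>
     (\<forall>x\<in>{0<..<L}. w differentiable (at x) \<and> deriv w differentiable (at x) \<and>
        - \<epsilon> * deriv (deriv w) x + b * deriv w x = f x) \<and>
     w 0 = 0 \<and> w L = 0"

text \<open>``Linear'' on a mesh interval is meant in the sense of affine.\<close>

definition continuous_pw_linear :: "nat \<Rightarrow> (real \<Rightarrow> real) \<Rightarrow> bool" where
  "continuous_pw_linear n w \<longleftrightarrow>
     continuous_on {0..1} w \<and>
     (\<forall>i\<in>{1..n}. \<exists>m c. \<forall>x\<in>{node n (i - 1)..node n i}. w x = m * x + c)"

definition hat_function :: "nat \<Rightarrow> nat \<Rightarrow> (real \<Rightarrow> real) \<Rightarrow> bool" where
  "hat_function n j \<phi> \<longleftrightarrow>
     continuous_pw_linear n \<phi> \<and> (\<forall>i\<in>{0..n}. \<phi> (node n i) = (if i = j then 1 else 0))"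

definition pw_linear_interpolant :: "nat \<Rightarrow> (real \<Rightarrow> real) \<Rightarrow> (real \<Rightarrow> real) \<Rightarrow> bool" where
  "pw_linear_interpolant n u w \<longleftrightarrow>
     continuous_pw_linear n w \<and> (\<forall>i\<in>{0..n}. w (node n i) = u (node n i))"

definition exponential_bubble :: "real \<Rightarrow> real \<Rightarrow> (real \<Rightarrow> real) \<Rightarrow> bool" where
  "exponential_bubble \<epsilon> h B \<longleftrightarrow> bvp_solution \<epsilon> (-1) (\<lambda>_. 1 / h) h B"

definition element_bubble :: "nat \<Rightarrow> (real \<Rightarrow> real) \<Rightarrow> nat \<Rightarrow> real \<Rightarrow> real" where
  "element_bubble n B i x =
     (if x \<in> {node n (i - 1)..node n i} then B (x - node n (i - 1)) else 0)"

definition test_function ::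
    "nat \<Rightarrow> (nat \<Rightarrow> real \<Rightarrow> real) \<Rightarrow> (real \<Rightarrow> real) \<Rightarrow> nat \<Rightarrow> real \<Rightarrow> real" where
  "test_function n \<phi> B j x = \<phi> j x + element_bubble n B j x - element_bubble n B (j + 1) x"

definition fun_span :: "nat \<Rightarrow> (nat \<Rightarrow> real \<Rightarrow> real) \<Rightarrow> (real \<Rightarrow> real) set" where
  "fun_span n g = {(\<lambda>x. \<Sum>j = 1..n - 1. c j * g j x) | c :: nat \<Rightarrow> real. True}"

definition trial_space :: "nat \<Rightarrow> (nat \<Rightarrow> real \<Rightarrow> real) \<Rightarrow> (real \<Rightarrow> real) set" where
  "trial_space n \<phi> = fun_span n \<phi>"

definition test_space ::
    "nat \<Rightarrow> (nat \<Rightarrow> real \<Rightarrow> real) \<Rightarrow> (real \<Rightarrow> real) \<Rightarrow> (real \<Rightarrow> real) set" where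
  "test_space n \<phi> B = fun_span n (test_function n \<phi> B)"

text \<open>
  Trial and test functions are differentiable away from the nodes; the unspecified values of
  \<^const>\<open>deriv\<close> at the finitely many nodes do not affect the integrals.
\<close>

definition petrov_galerkin_solution ::
    "real \<Rightarrow> (real \<Rightarrow> real) \<Rightarrow> (real \<Rightarrow> real) set \<Rightarrow> (real \<Rightarrow> real) set \<Rightarrow> (real \<Rightarrow> real) \<Rightarrow> bool" where
  "petrov_galerkin_solution \<epsilon> f M V w \<longleftrightarrow>
     w \<in> M \<and>
     (\<forall>v\<in>V. \<epsilon> * integral {0..1} (\<lambda>x. deriv w x * deriv v x)
              + integral {0..1} (\<lambda>x. deriv w x * v x)
            = integral {0..1} (\<lambda>x. f x * v x))"

text \<open>The notions above that are specified by their properties are inhabited.\<close>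

lemma hat_function_exists:
  assumes "n \<ge> 1"
  shows "hat_function n j (\<lambda>x. max 0 (1 - \<bar>real n * x - real j\<bar>))"
proof -
  let ?w = "\<lambda>x. max 0 (1 - \<bar>real n * x - real j\<bar>)"
  have n: "real n > 0" using assms by simp
  have "\<exists>m c. \<forall>x\<in>{node n (i - 1)..node n i}. ?w x = m * x + c" if i: "i \<in> {1..n}" for i
  proof -
    have r: "real i - 1 \<le> real n * x \<and> real n * x \<le> real i"
      if "x \<in> {node n (i - 1)..node n i}" for x
      using that i n by (auto simp: node_def mesh_width_def field_simps)
    consider "i = j" | "i = j + 1" | "i < j" | "i > j + 1" by linarith
    then show ?thesis
    proof cases
      case 1
      have "\<forall>x\<in>{node n (i - 1)..node n i}. ?w x = real n * x + (1 - real j)"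
        by (intro ballI, drule r) (use 1 in linarith)
      then show ?thesis by blast
    next
      case 2
      have "\<forall>x\<in>{node n (i - 1)..node n i}. ?w x = (- real n) * x + (1 + real j)"
        by (intro ballI, drule r) (use 2 in linarith)
      then show ?thesis by blast
    next
      case 3
      then have far: "real i \<le> real j - 1" by linarith
      have "\<forall>x\<in>{node n (i - 1)..node n i}. ?w x = 0 * x + 0"
        by (intro ballI, drule r) (use far in linarith)
      then show ?thesis by blast
    next
      case 4
      then have far: "real i - 1 \<ge> real j + 1" by linarith
      have "\<forall>x\<in>{node n (i - 1)..node n i}. ?w x = 0 * x + 0"
        by (intro ballI, drule r) (use far in linarith)
      then show ?thesis by blast
    qed
  qed
  moreover have "continuous_on {0..1} ?w" by (intro continuous_intros)
  moreover have "?w (node n i) = (if i = j then 1 else 0)" for i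
    using n by (auto simp: node_def mesh_width_def)
  ultimately show ?thesis
    unfolding hat_function_def continuous_pw_linear_def by blast
qed

lemma pw_linear_interpolant_exists:
  assumes "n \<ge> 1"
  shows "\<exists>w. pw_linear_interpolant n u w"
proof -
  define \<phi> where "\<phi> = (\<lambda>j x. max 0 (1 - \<bar>real n * x - real j\<bar>))"
  have \<phi>: "hat_function n j (\<phi> j)" for j
    unfolding \<phi>_def using hat_function_exists[OF assms] .
  define w where "w = (\<lambda>x. \<Sum>j = 0..n. u (node n j) * \<phi> j x)"
  have "continuous_on {0..1} w"
    unfolding w_def \<phi>_def by (intro continuous_intros)
  moreover have "\<exists>m c. \<forall>x\<in>{node n (i - 1)..node n i}. w x = m * x + c" if "i \<in> {1..n}" for i
  proof -
    have "\<forall>j. \<exists>m c. \<forall>x\<in>{node n (i - 1)..node n i}. \<phi> j x = m * x + c"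
      using \<phi> that by (simp only: hat_function_def continuous_pw_linear_def simp_thms)
    then obtain m where "\<forall>j. \<exists>c. \<forall>x\<in>{node n (i - 1)..node n i}. \<phi> j x = m j * x + c"
      by (metis (no_types, lifting))
    then obtain c where mc: "\<And>j x. x \<in> {node n (i - 1)..node n i} \<Longrightarrow> \<phi> j x = m j * x + c j"
      by (metis (no_types, lifting))
    have "w x = (\<Sum>j = 0..n. u (node n j) * m j) * x + (\<Sum>j = 0..n. u (node n j) * c j)"
      if "x \<in> {node n (i - 1)..node n i}" for x
      unfolding w_def using mc[OF that]
      by (simp add: distrib_left sum.distrib sum_distrib_right mult.assoc)
    then show ?thesis by blast
  qed
  moreover have "w (node n i) = u (node n i)" if "i \<in> {0..n}" for i
  proof -
    have "w (node n i) = (\<Sum>j = 0..n. if j = i then u (node n j) else 0)"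
      unfolding w_def using \<phi> that by (intro sum.cong) (auto simp: hat_function_def)
    then show ?thesis using that by simp
  qed
  ultimately show ?thesis
    unfolding pw_linear_interpolant_def continuous_pw_linear_def by blast
qed

lemma exponential_bubble_exists:
  assumes "\<epsilon> > 0" "h > 0"
  shows "exponential_bubble \<epsilon> h (\<lambda>x. (1 - exp (- x / \<epsilon>)) / (1 - exp (- h / \<epsilon>)) - x / h)"
proof -
  define C where "C = 1 - exp (- h / \<epsilon>)"
  have C: "C \<noteq> 0" using assms by (simp add: C_def)
  let ?B = "\<lambda>x. (1 - exp (- x / \<epsilon>)) / C - x / h"
  have d1: "(?B has_real_derivative exp (- x / \<epsilon>) / (\<epsilon> * C) - 1 / h) (at x)" for x
    using assms C by (auto intro!: derivative_eq_intros simp: field_simps)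
  have e1: "deriv ?B = (\<lambda>x. exp (- x / \<epsilon>) / (\<epsilon> * C) - 1 / h)"
    using DERIV_imp_deriv[OF d1] by blast
  have d2: "(deriv ?B has_real_derivative - exp (- x / \<epsilon>) / (\<epsilon> * \<epsilon> * C)) (at x)" for x
    unfolding e1 using assms C by (auto intro!: derivative_eq_intros simp: field_simps)
  have e2: "deriv (deriv ?B) x = - exp (- x / \<epsilon>) / (\<epsilon> * \<epsilon> * C)" for x
    using DERIV_imp_deriv[OF d2] .
  have "continuous_on {0..h} ?B"
    using assms C by (intro continuous_intros) auto
  moreover have "?B differentiable (at x)" "deriv ?B differentiable (at x)" for x
    using d1 d2 real_differentiable_def by blast+
  moreover have "- \<epsilon> * deriv (deriv ?B) x + - 1 * deriv ?B x = 1 / h" for x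
    unfolding e2 unfolding e1 using assms C by (simp add: field_simps)
  moreover have "?B 0 = 0" "?B h = 0" using assms C by (simp_all add: C_def)
  ultimately show ?thesis
    unfolding exponential_bubble_def bvp_solution_def C_def by blast
qed

end

theory Submission
  imports Defs
begin

text \<open>
  Nodal exactness holds because the test functions lie in the kernel of the adjoint operator: on each
  mesh element, \<open>g\<^sub>j\<close> satisfies \<open>-\<epsilon> g'' - g' = 0\<close>, so that \<open>\<epsilon> g' + g\<close> is a constant \<open>\<kappa>\<close> there. The
  bubble is what turns the hat function into such a solution.

  On an element \<open>[a, b]\<close> the bilinear form, applied to an affine function \<open>w\<close> and to \<open>g\<close>, then has the
  value \<open>\<kappa> (w b - w a)\<close> (\<open>element_bilinear_form\<close>). On the other hand \<open>f g\<close> is the derivative of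
  \<open>\<kappa> u - \<epsilon> u' g\<close>, so the load on the same element is \<open>\<kappa> (u b - u a)\<close> minus the increment of
  \<open>\<epsilon> u' g\<close> (\<open>element_load\<close>). Summed over all elements, these increments telescope to zero, because
  \<open>g\<close> vanishes at both ends of \<open>[0, 1]\<close>; \<open>bvp_flux\<close> supplies a version of \<open>\<epsilon> u'\<close> that is continuous
  up to these ends. Hence the nodal error \<open>e\<^sub>i = u\<^sub>h(x\<^sub>i) - u(x\<^sub>i)\<close> satisfies
  \<open>\<Sum>\<^sub>i \<kappa>\<^sub>i (e\<^sub>i - e\<^sub>i\<^sub>-\<^sub>1) = 0\<close> for every test function.

  For \<open>g\<^sub>j\<close> the constants are \<open>K\<close> on the element left of \<open>x\<^sub>j\<close>, \<open>1 - K\<close> on the element right of it, and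
  zero elsewhere, with \<open>K = 1 / (1 - exp (-h/\<epsilon>)) > 1\<close>. The increments of \<open>e\<close> thus form a geometric
  sequence with the positive ratio \<open>K / (K - 1)\<close>. They add up to \<open>e\<^sub>n - e\<^sub>0 = 0\<close>, and this forces all
  of them to vanish (\<open>geometric_increments_vanish\<close>).
\<close>

section \<open>Mesh and piecewise linear functions\<close>

lemma mesh_width_pos: "n \<ge> 1 \<Longrightarrow> mesh_width n > 0"
  by (simp add: mesh_width_def)

lemma node_0: "node n 0 = 0"
  by (simp add: node_def)

lemma node_last: "n \<ge> 1 \<Longrightarrow> node n n = 1"
  by (simp add: node_def mesh_width_def)

lemma node_step: "i \<ge> 1 \<Longrightarrow> node n i = node n (i - 1) + mesh_width n"
  by (cases i) (auto simp: node_def algebra_simps)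

lemma node_mono: "i \<le> j \<Longrightarrow> node n i \<le> node n j"
  by (simp add: node_def mesh_width_def divide_right_mono)

lemma node_less: "n \<ge> 1 \<Longrightarrow> i < j \<Longrightarrow> node n i < node n j"
  by (simp add: node_def mesh_width_def divide_strict_right_mono)

lemma element_subset_unit:
  assumes "i \<in> {1..n}"
  shows "{node n (i - 1)..node n i} \<subseteq> {0..1}"
  using node_mono[of 0 "i - 1" n] node_mono[of i n n] assms node_last[of n] node_0[of n] by auto

lemma unit_interval_covered_by_elements:
  assumes "n \<ge> 1" "x \<in> {0..1}"
  obtains i where "i \<in> {1..n}" "x \<in> {node n (i - 1)..node n i}"
proof -
  have "\<exists>i\<in>{1..k}. x \<in> {node n (i - 1)..node n i}" if "k \<ge> 1" "x \<le> node n k" for k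
    using that
  proof (induction k rule: dec_induct)
    case base
    then show ?case using assms by (auto simp: node_0)
  next
    case (step k)
    show ?case
    proof (cases "x \<le> node n k")
      case True
      then obtain i where "i \<in> {1..k}" "x \<in> {node n (i - 1)..node n i}" using step by blast
      then show ?thesis by (intro bexI[of _ i]) auto
    next
      case False
      then show ?thesis using step by (intro bexI[of _ "Suc k"]) auto
    qed
  qed
  from this[OF assms(1)] show ?thesis using that assms node_last[of n] by fastforce
qed

lemma has_integral_sum_elements:
  fixes F :: "real \<Rightarrow> real"
  assumes "n \<ge> 1"
    and "\<And>i. i \<in> {1..n} \<Longrightarrow> (F has_integral I i) {node n (i - 1)..node n i}"
  shows "(F has_integral (\<Sum>i = 1..n. I i)) {0..1}"
proof -
  have "(F has_integral (\<Sum>i = 1..k. I i)) {0..node n k}" if "k \<le> n" for k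
    using that
  proof (induction k)
    case 0
    then show ?case by (simp add: node_0 has_integral_refl)
  next
    case (Suc k)
    have "(F has_integral (\<Sum>i = 1..k. I i) + I (Suc k)) {0..node n (Suc k)}"
      using Suc assms(2)[of "Suc k"] node_mono[of 0 k n] node_mono[of k "Suc k" n]
      by (intro has_integral_combine[where c = "node n k"]) (auto simp: node_0)
    then show ?case by simp
  qed
  from this[of n] show ?thesis using node_last[OF assms(1)] by simp
qed

lemma continuous_pw_linear_on_element:
  assumes "continuous_pw_linear n w" "i \<in> {1..n}" "x \<in> {node n (i - 1)..node n i}"
  shows "w x = w (node n (i - 1))
    + (w (node n i) - w (node n (i - 1))) * ((x - node n (i - 1)) / mesh_width n)"
proof -
  obtain m c where mc: "\<And>y. y \<in> {node n (i - 1)..node n i} \<Longrightarrow> w y = m * y + c"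
    using assms(1,2) unfolding continuous_pw_linear_def by blast
  have h: "mesh_width n > 0" using assms(2) by (intro mesh_width_pos) auto
  have s: "node n i = node n (i - 1) + mesh_width n" using assms(2) node_step by auto
  have "w (node n (i - 1)) = m * node n (i - 1) + c" "w (node n i) = m * node n i + c" "w x = m * x + c"
    using mc h s assms(3) by auto
  then show ?thesis using h by (simp add: s field_simps)
qed

lemma continuous_pw_linear_sum:
  assumes "\<And>j. j \<in> J \<Longrightarrow> continuous_pw_linear n (\<phi> j)"
  shows "continuous_pw_linear n (\<lambda>x. \<Sum>j\<in>J. c j * \<phi> j x)"
  unfolding continuous_pw_linear_def
proof (intro conjI ballI)
  show "continuous_on {0..1} (\<lambda>x. \<Sum>j\<in>J. c j * \<phi> j x)"
    using assms unfolding continuous_pw_linear_def by (intro continuous_intros) auto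
next
  fix i assume i: "i \<in> {1..n}"
  have "\<forall>j\<in>J. \<exists>m d. \<forall>x\<in>{node n (i - 1)..node n i}. \<phi> j x = m * x + d"
    using assms i unfolding continuous_pw_linear_def by blast
  then obtain m d where
    md: "\<And>j x. j \<in> J \<Longrightarrow> x \<in> {node n (i - 1)..node n i} \<Longrightarrow> \<phi> j x = m j * x + d j"
    by metis
  have "(\<Sum>j\<in>J. c j * \<phi> j x) = (\<Sum>j\<in>J. c j * m j) * x + (\<Sum>j\<in>J. c j * d j)"
    if "x \<in> {node n (i - 1)..node n i}" for x
  proof -
    have "(\<Sum>j\<in>J. c j * \<phi> j x) = (\<Sum>j\<in>J. c j * m j * x + c j * d j)"
      using md that by (intro sum.cong) (auto simp: algebra_simps)
    then show ?thesis by (simp add: sum.distrib sum_distrib_right)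
  qed
  then show "\<exists>m d. \<forall>x\<in>{node n (i - 1)..node n i}. (\<Sum>j\<in>J. c j * \<phi> j x) = m * x + d" by blast
qed

lemma continuous_pw_linear_eqI:
  assumes "n \<ge> 1" "continuous_pw_linear n v" "continuous_pw_linear n w"
    and "\<And>i. i \<le> n \<Longrightarrow> v (node n i) = w (node n i)" "x \<in> {0..1}"
  shows "v x = w x"
proof -
  obtain i where i: "i \<in> {1..n}" "x \<in> {node n (i - 1)..node n i}"
    using unit_interval_covered_by_elements assms by blast
  have "v (node n (i - 1)) = w (node n (i - 1))" "v (node n i) = w (node n i)"
    using assms(4)[of i] assms(4)[of "i - 1"] i(1) by auto
  then show ?thesis
    using continuous_pw_linear_on_element[OF assms(2) i] continuous_pw_linear_on_element[OF assms(3) i]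
    by simp
qed

section \<open>The flux of a classical solution\<close>

text \<open>
  The differential equation reads \<open>(\<epsilon> w')' = (b w - F)'\<close> with a primitive \<open>F\<close> of \<open>f\<close>. Thus \<open>\<epsilon> w'\<close>
  differs from \<open>b w - F\<close> by a constant and inherits its continuity up to the end points, where \<open>w\<close> is
  not assumed differentiable.
\<close>

lemma bvp_flux:
  assumes "\<epsilon> > 0" "L > 0" "continuous_on {0..L} f" "bvp_solution \<epsilon> b f L w"
  obtains \<sigma> where "continuous_on {0..L} \<sigma>"
    and "\<And>x. x \<in> {0<..<L} \<Longrightarrow> (w has_real_derivative \<sigma> x / \<epsilon>) (at x)"
    and "\<And>x. x \<in> {0<..<L} \<Longrightarrow> (\<sigma> has_real_derivative b * (\<sigma> x / \<epsilon>) - f x) (at x)"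
proof -
  define F where "F = (\<lambda>x. integral {0..x} f)"
  have w: "continuous_on {0..L} w"
    "\<And>x. x \<in> {0<..<L} \<Longrightarrow> (w has_real_derivative deriv w x) (at x)"
    "\<And>x. x \<in> {0<..<L} \<Longrightarrow> (deriv w has_real_derivative deriv (deriv w) x) (at x)"
    "\<And>x. x \<in> {0<..<L} \<Longrightarrow> \<epsilon> * deriv (deriv w) x = b * deriv w x - f x"
    using assms(4) unfolding bvp_solution_def
    by (auto simp: DERIV_deriv_iff_real_differentiable) (force simp: algebra_simps)
  have F: "continuous_on {0..L} F"
    unfolding F_def using assms by (intro indefinite_integral_continuous_1 integrable_continuous_real)
  have dF: "(F has_real_derivative f x) (at x)" if "x \<in> {0<..<L}" for x
  proof -
    have "(F has_real_derivative f x) (at x within {0..L})"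
      unfolding F_def using that assms by (intro integral_has_real_derivative) auto
    then show ?thesis using that by (simp add: at_within_Icc_at)
  qed
  have "\<exists>c. \<forall>x\<in>{0<..<L}. \<epsilon> * deriv w x - (b * w x - F x) = c"
  proof (rule has_field_derivative_zero_constant)
    fix x assume x: "x \<in> {0<..<L}"
    have "((\<lambda>x. \<epsilon> * deriv w x - (b * w x - F x)) has_real_derivative
        \<epsilon> * deriv (deriv w) x - (b * deriv w x - f x)) (at x)"
      by (intro DERIV_diff DERIV_cmult w(2,3) dF x)
    then show "((\<lambda>x. \<epsilon> * deriv w x - (b * w x - F x)) has_real_derivative 0) (at x within {0<..<L})"
      using w(4)[OF x] by (auto intro: has_field_derivative_at_within)
  qed simp
  then obtain c where c: "\<And>x. x \<in> {0<..<L} \<Longrightarrow> \<epsilon> * deriv w x - (b * w x - F x) = c"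
    by blast
  define \<sigma> where "\<sigma> = (\<lambda>x. b * w x - F x + c)"
  have dw: "deriv w x = \<sigma> x / \<epsilon>" if "x \<in> {0<..<L}" for x
    using c[OF that] assms(1) by (simp add: \<sigma>_def field_simps)
  show ?thesis
  proof (rule that[of \<sigma>])
    show "continuous_on {0..L} \<sigma>" unfolding \<sigma>_def by (intro continuous_intros w F)
  next
    fix x assume x: "x \<in> {0<..<L}"
    show "(w has_real_derivative \<sigma> x / \<epsilon>) (at x)" using w(2)[OF x] dw[OF x] by simp
    have "(\<sigma> has_real_derivative b * deriv w x - f x + 0) (at x)"
      unfolding \<sigma>_def by (intro DERIV_add DERIV_diff DERIV_cmult DERIV_const w(2) dF x)
    then show "(\<sigma> has_real_derivative b * (\<sigma> x / \<epsilon>) - f x) (at x)" using dw[OF x] by simp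
  qed
qed

section \<open>Test functions solve the adjoint equation on each element\<close>

text \<open>
  Adding the rising half of a hat function to the bubble removes the right-hand side \<open>1/h\<close> of the
  bubble equation. For the sum \<open>G\<close> the quantity \<open>\<epsilon> G' + G = K\<close> is therefore constant, and so is
  \<open>(G - K) exp (t/\<epsilon>)\<close>. Comparing its values at \<open>t = 0\<close>, where \<open>G = 0\<close>, and at \<open>t = h\<close>, where \<open>G = 1\<close>,
  determines \<open>K\<close>; only \<open>K > 1\<close> matters.
\<close>

lemma bubble_plus_linear:
  assumes "\<epsilon> > 0" "h > 0" "exponential_bubble \<epsilon> h B"
  obtains K where "K > 1"
    and "\<And>t. t \<in> {0<..<h} \<Longrightarrow>
      ((\<lambda>t. t / h + B t) has_real_derivative (K - (t / h + B t)) / \<epsilon>) (at t)"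
proof -
  define G where "G = (\<lambda>t. t / h + B t)"
  have bvp: "bvp_solution \<epsilon> (-1) (\<lambda>_. 1 / h) h B"
    using assms(3) by (simp add: exponential_bubble_def)
  then have B: "continuous_on {0..h} B" "B 0 = 0" "B h = 0" by (auto simp: bvp_solution_def)
  obtain \<sigma> where \<sigma>: "continuous_on {0..h} \<sigma>"
    "\<And>x. x \<in> {0<..<h} \<Longrightarrow> (B has_real_derivative \<sigma> x / \<epsilon>) (at x)"
    "\<And>x. x \<in> {0<..<h} \<Longrightarrow> (\<sigma> has_real_derivative -1 * (\<sigma> x / \<epsilon>) - 1 / h) (at x)"
    using bvp_flux[OF assms(1,2) _ bvp] by auto
  have G: "continuous_on {0..h} G" "G 0 = 0" "G h = 1"
    unfolding G_def using B assms by (auto intro!: continuous_intros)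
  have dG: "(G has_real_derivative 1 / h + \<sigma> x / \<epsilon>) (at x)" if "x \<in> {0<..<h}" for x
    unfolding G_def by (intro derivative_intros \<sigma> that DERIV_cdivide)
  define K where "K = \<epsilon> / h + (\<sigma> 0 + G 0)"
  have const: "\<sigma> x + G x = \<sigma> 0 + G 0" if "x \<in> {0<..<h}" for x
  proof (rule DERIV_isconst2[where a = 0 and b = h and f = "\<lambda>x. \<sigma> x + G x"])
    show "continuous_on {0..h} (\<lambda>x. \<sigma> x + G x)" by (intro continuous_intros \<sigma> G)
    fix y assume "0 < y" "y < h"
    then have "((\<lambda>x. \<sigma> x + G x) has_real_derivative
        (-1 * (\<sigma> y / \<epsilon>) - 1 / h) + (1 / h + \<sigma> y / \<epsilon>)) (at y)"
      by (intro derivative_intros \<sigma> dG) auto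
    then show "((\<lambda>x. \<sigma> x + G x) has_real_derivative 0) (at y)" by simp
  qed (use that assms in auto)
  have ode: "(G has_real_derivative (K - G x) / \<epsilon>) (at x)" if "x \<in> {0<..<h}" for x
  proof -
    have "1 / h + \<sigma> x / \<epsilon> = (K - G x) / \<epsilon>"
      unfolding K_def const[OF that, symmetric] using assms by (simp add: field_simps)
    then show ?thesis using dG[OF that] by simp
  qed
  have "(G h - K) * exp (h / \<epsilon>) = (G 0 - K) * exp (0 / \<epsilon>)"
  proof (rule DERIV_isconst2[where a = 0 and b = h and f = "\<lambda>x. (G x - K) * exp (x / \<epsilon>)"])
    show "continuous_on {0..h} (\<lambda>x. (G x - K) * exp (x / \<epsilon>))"
      by (intro continuous_intros G) (use assms in auto)
    fix x assume "0 < x" "x < h"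
    then have "(G has_real_derivative (K - G x) / \<epsilon>) (at x)" by (intro ode) auto
    then show "((\<lambda>x. (G x - K) * exp (x / \<epsilon>)) has_real_derivative 0) (at x)"
      using assms by (auto intro!: derivative_eq_intros simp: field_simps)
  qed (use assms in auto)
  then have "(K - 1) * (exp (h / \<epsilon>) - 1) = 1" by (simp add: G algebra_simps)
  moreover have "exp (h / \<epsilon>) - 1 > 0" using assms by simp
  ultimately have "K - 1 > 0" by (metis zero_less_mult_pos2 zero_less_one)
  then show ?thesis using ode that unfolding G_def by auto
qed

lemma hat_function_on_element:
  assumes "hat_function n j \<phi>" "j \<ge> 1" "i \<in> {1..n}" "x \<in> {node n (i - 1)..node n i}"
  shows "\<phi> x = (if i = j then (x - node n (i - 1)) / mesh_width n
    else if i = j + 1 then 1 - (x - node n (i - 1)) / mesh_width n else 0)"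
proof -
  have "i \<in> {0..n}" "i - 1 \<in> {0..n}" using assms(3) by auto
  then have "\<phi> (node n i) = (if i = j then 1 else 0)"
    "\<phi> (node n (i - 1)) = (if i - 1 = j then 1 else 0)"
    using assms(1) unfolding hat_function_def by blast+
  moreover have "continuous_pw_linear n \<phi>" using assms(1) by (simp add: hat_function_def)
  ultimately show ?thesis
    using continuous_pw_linear_on_element[OF _ assms(3,4), of \<phi>] assms(2,3)
    by (auto split: if_splits)
qed

text \<open>
  The supports of different element bubbles meet at nodes only, where the bubble vanishes; the
  description is thus valid on the closed element.
\<close>

lemma element_bubble_on_element:
  assumes "B 0 = 0" "B (mesh_width n) = 0"
    and "k \<ge> 1" "i \<in> {1..n}" "x \<in> {node n (i - 1)..node n i}"
  shows "element_bubble n B k x = (if i = k then B (x - node n (i - 1)) else 0)"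
proof -
  have n: "n \<ge> 1" using assms(4) by auto
  consider "i = k" | "i < k" | "i > k" by linarith
  then show ?thesis
  proof cases
    case 1
    then show ?thesis using assms by (simp add: element_bubble_def)
  next
    case 2
    then have "node n i \<le> node n (k - 1)" by (intro node_mono) auto
    then have "x = node n (k - 1)" if "x \<in> {node n (k - 1)..node n k}"
      using that assms(5) by auto
    then show ?thesis using 2 assms(1) by (auto simp: element_bubble_def)
  next
    case 3
    then have "node n k \<le> node n (i - 1)" by (intro node_mono) auto
    then have "x = node n k" if "x \<in> {node n (k - 1)..node n k}"
      using that assms(5) by auto
    then have "x - node n (k - 1) = mesh_width n" if "x \<in> {node n (k - 1)..node n k}"
      using that node_step[OF assms(3), of n] by auto
    then show ?thesis using 3 assms(2) by (auto simp: element_bubble_def)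
  qed
qed

lemma test_function_on_element:
  fixes B :: "real \<Rightarrow> real"
  defines "G \<equiv> \<lambda>h t. t / h + B t"
  assumes "hat_function n j (\<phi> j)" "B 0 = 0" "B (mesh_width n) = 0"
    and "j \<ge> 1" "i \<in> {1..n}" "x \<in> {node n (i - 1)..node n i}"
  shows "test_function n \<phi> B j x =
    (if i = j then G (mesh_width n) (x - node n (i - 1))
     else if i = j + 1 then 1 - G (mesh_width n) (x - node n (i - 1)) else 0)"
  unfolding test_function_def G_def
  using hat_function_on_element[OF assms(2,5-7)] element_bubble_on_element[of B n _ i x] assms
  by auto

lemma test_function_boundary:
  assumes "hat_function n j (\<phi> j)" "B 0 = 0" "B (mesh_width n) = 0" "j \<in> {1..n - 1}"
  shows "test_function n \<phi> B j 0 = 0" "test_function n \<phi> B j 1 = 0"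
proof -
  have n: "n \<ge> 1" and h: "mesh_width n > 0" using assms(4) by (auto intro: mesh_width_pos)
  have "test_function n \<phi> B j 0 = (if 1 = j then 0 / mesh_width n + B 0
      else if 1 = j + 1 then 1 - (0 / mesh_width n + B 0) else 0)"
    using test_function_on_element[of n j \<phi> B 1 0] assms n node_mono[of 0 1 n]
    by (simp add: node_0)
  then show "test_function n \<phi> B j 0 = 0" using assms by auto
  have "1 - node n (n - 1) = mesh_width n"
    using node_step[of n n] node_last[of n] n by simp
  then show "test_function n \<phi> B j 1 = 0"
    using test_function_on_element[of n j \<phi> B n 1] assms n h node_last[of n] by auto
qed

definition adjoint_flux :: "real \<Rightarrow> nat \<Rightarrow> nat \<Rightarrow> real" where
  "adjoint_flux K j i = (if i = j then K else if i = j + 1 then 1 - K else 0)"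

lemma test_function_adjoint_equation:
  assumes "\<epsilon> > 0" "exponential_bubble \<epsilon> (mesh_width n) B" "n \<ge> 1"
  obtains K where "K > 1"
    and "\<And>j i x. \<lbrakk>hat_function n j (\<phi> j); j \<ge> 1; i \<in> {1..n}; x \<in> {node n (i - 1)<..<node n i}\<rbrakk> \<Longrightarrow>
      (test_function n \<phi> B j has_real_derivative
        (adjoint_flux K j i - test_function n \<phi> B j x) / \<epsilon>) (at x)"
proof -
  let ?h = "mesh_width n"
  have h: "?h > 0" using assms(3) mesh_width_pos by simp
  have B: "B 0 = 0" "B ?h = 0"
    using assms(2) by (auto simp: exponential_bubble_def bvp_solution_def)
  define G where "G = (\<lambda>t. t / ?h + B t)"
  obtain K where K: "K > 1"
    "\<And>t. t \<in> {0<..<?h} \<Longrightarrow> (G has_real_derivative (K - G t) / \<epsilon>) (at t)"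
    unfolding G_def using bubble_plus_linear[OF assms(1) h assms(2)] by metis
  show ?thesis
  proof (rule that[OF K(1)])
    fix j i x
    assume j: "hat_function n j (\<phi> j)" "j \<ge> 1" and i: "i \<in> {1..n}"
      and x: "x \<in> {node n (i - 1)<..<node n i}"
    let ?a = "node n (i - 1)"
    define g where "g = (\<lambda>x. if i = j then G (x - ?a) else if i = j + 1 then 1 - G (x - ?a) else 0)"
    have eq: "test_function n \<phi> B j y = g y" if "y \<in> {?a<..<node n i}" for y
      unfolding g_def G_def using test_function_on_element[where \<phi> = \<phi> and j = j, OF j(1) B j(2) i, of y] that by simp
    have "x - ?a \<in> {0<..<?h}" using x node_step[of i n] i by auto
    then have "((\<lambda>x. G (x + - ?a)) has_real_derivative (K - G (x + - ?a)) / \<epsilon>) (at x)"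
      using K(2)[of "x - ?a"] by (intro DERIV_shift[THEN iffD1]) simp
    then have dG: "((\<lambda>x. G (x - ?a)) has_real_derivative (K - G (x - ?a)) / \<epsilon>) (at x)"
      by simp
    have "(g has_real_derivative (adjoint_flux K j i - g x) / \<epsilon>) (at x)"
    proof -
      have "((\<lambda>x. 1 - G (x - ?a)) has_real_derivative 0 - (K - G (x - ?a)) / \<epsilon>) (at x)"
        by (intro derivative_intros dG)
      then have "((\<lambda>x. 1 - G (x - ?a)) has_real_derivative ((1 - K) - (1 - G (x - ?a))) / \<epsilon>) (at x)"
        by (simp add: diff_divide_distrib)
      then show ?thesis using dG by (auto simp: g_def adjoint_flux_def)
    qed
    then have "(test_function n \<phi> B j has_real_derivative (adjoint_flux K j i - g x) / \<epsilon>) (at x)"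
      by (rule has_field_derivative_transform_within_open[where S = "{?a<..<node n i}"])
        (use eq x in auto)
    then show "(test_function n \<phi> B j has_real_derivative
        (adjoint_flux K j i - test_function n \<phi> B j x) / \<epsilon>) (at x)"
      using eq[OF x] by simp
  qed
qed

lemma test_function_continuous_on_element:
  assumes "hat_function n j (\<phi> j)" "exponential_bubble \<epsilon> (mesh_width n) B" "j \<ge> 1" "i \<in> {1..n}"
  shows "continuous_on {node n (i - 1)..node n i} (test_function n \<phi> B j)"
proof -
  let ?a = "node n (i - 1)" and ?h = "mesh_width n"
  have B: "continuous_on {0..?h} B" "B 0 = 0" "B ?h = 0"
    using assms(2) by (auto simp: exponential_bubble_def bvp_solution_def)
  have h: "?h > 0" using assms(4) by (intro mesh_width_pos) auto
  have "continuous_on {?a..node n i} (\<lambda>x. B (x - ?a))"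
    using node_step[of i n] assms(4)
    by (intro continuous_on_compose2[OF B(1)] continuous_intros) auto
  then have "continuous_on {?a..node n i} (\<lambda>x. if i = j then (x - ?a) / ?h + B (x - ?a)
      else if i = j + 1 then 1 - ((x - ?a) / ?h + B (x - ?a)) else 0)"
    using h by (cases "i = j"; cases "i = j + 1") (simp_all add: continuous_intros)
  then show ?thesis
    by (rule continuous_on_eq)
      (use test_function_on_element[where \<phi> = \<phi> and j = j, OF assms(1) B(2,3) assms(3,4)] in simp)
qed

section \<open>The discrete equation on one element\<close>

text \<open>
  With the slope \<open>m\<close> of \<open>w\<close>, the two integrands combine to \<open>m (\<epsilon> g' + g) = m \<kappa>\<close>. Integrability
  up to the ends of the element comes from \<open>\<epsilon> g' = \<kappa> - g\<close>, whose right-hand side is continuous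
  there.
\<close>

lemma element_bilinear_form:
  fixes w g :: "real \<Rightarrow> real"
  assumes "\<epsilon> > 0" "a < b"
    and w: "\<And>x. x \<in> {a..b} \<Longrightarrow> w x = w a + (w b - w a) * ((x - a) / (b - a))"
    and g: "continuous_on {a..b} g"
    and ode: "\<And>x. x \<in> {a<..<b} \<Longrightarrow> (g has_real_derivative (\<kappa> - g x) / \<epsilon>) (at x)"
  shows "(\<lambda>x. deriv w x * deriv g x) integrable_on {a..b}"
    and "(\<lambda>x. deriv w x * g x) integrable_on {a..b}"
    and "\<epsilon> * integral {a..b} (\<lambda>x. deriv w x * deriv g x) + integral {a..b} (\<lambda>x. deriv w x * g x)
      = \<kappa> * (w b - w a)"
proof -
  define m where "m = (w b - w a) / (b - a)"
  have affine: "w a + m * (x - a) = w x" if "x \<in> {a<..<b}" for x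
    using w[of x] that unfolding m_def by fastforce
  have dw: "deriv w x = m" if x: "x \<in> {a<..<b}" for x
  proof -
    have "((\<lambda>x. w a + m * (x - a)) has_real_derivative m) (at x)"
      by (auto intro!: derivative_eq_intros)
    then have "(w has_real_derivative m) (at x)"
      by (rule has_field_derivative_transform_within_open[where S = "{a<..<b}"])
        (use x affine in auto)
    then show ?thesis by (rule DERIV_imp_deriv)
  qed
  have dg: "deriv g x = (\<kappa> - g x) / \<epsilon>" if "x \<in> {a<..<b}" for x
    using ode[OF that] by (rule DERIV_imp_deriv)
  let ?J = "integral {a..b} g"
  have J: "(g has_integral ?J) {a..b}"
    using g by (intro integrable_integral integrable_continuous_real)
  have const: "((\<lambda>x. \<kappa>) has_integral \<kappa> * (b - a)) {a..b}"
    using has_integral_const_real[of \<kappa> a b] assms(2) by (simp add: mult.commute)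
  have "((\<lambda>x. (m / \<epsilon>) * (\<kappa> - g x)) has_integral (m / \<epsilon>) * (\<kappa> * (b - a) - ?J)) {a..b}"
    by (intro has_integral_mult_right has_integral_diff const J)
  then have D: "((\<lambda>x. deriv w x * deriv g x) has_integral (m / \<epsilon>) * (\<kappa> * (b - a) - ?J)) {a..b}"
    by (rule has_integral_spike_finite[of "{a, b}", rotated 2]) (auto simp: dw dg)
  have "((\<lambda>x. m * g x) has_integral m * ?J) {a..b}"
    by (intro has_integral_mult_right J)
  then have C: "((\<lambda>x. deriv w x * g x) has_integral m * ?J) {a..b}"
    by (rule has_integral_spike_finite[of "{a, b}", rotated 2]) (auto simp: dw)
  have "\<epsilon> * ((m / \<epsilon>) * (\<kappa> * (b - a) - ?J)) + m * ?J = \<kappa> * (m * (b - a))"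
    using assms(1) by (simp add: algebra_simps)
  also have "m * (b - a) = w b - w a" using assms(2) by (simp add: m_def)
  finally show "\<epsilon> * integral {a..b} (\<lambda>x. deriv w x * deriv g x)
      + integral {a..b} (\<lambda>x. deriv w x * g x) = \<kappa> * (w b - w a)"
    using integral_unique[OF D] integral_unique[OF C] by (simp only:)
  show "(\<lambda>x. deriv w x * deriv g x) integrable_on {a..b}"
    "(\<lambda>x. deriv w x * g x) integrable_on {a..b}" using D C by blast+
qed

text \<open>
  With \<open>\<sigma> = \<epsilon> u'\<close>, the product \<open>f g = (u' - \<sigma>') g\<close> has the primitive \<open>\<kappa> u - \<sigma> g\<close>, because
  \<open>\<sigma> g' = u' (\<kappa> - g)\<close>.
\<close>

lemma element_load:
  fixes u \<sigma> f g :: "real \<Rightarrow> real"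
  assumes "\<epsilon> > 0" "a \<le> b"
    and "continuous_on {a..b} u" "continuous_on {a..b} \<sigma>" "continuous_on {a..b} g"
    and u: "\<And>x. x \<in> {a<..<b} \<Longrightarrow> (u has_real_derivative \<sigma> x / \<epsilon>) (at x)"
    and \<sigma>: "\<And>x. x \<in> {a<..<b} \<Longrightarrow> (\<sigma> has_real_derivative \<sigma> x / \<epsilon> - f x) (at x)"
    and g: "\<And>x. x \<in> {a<..<b} \<Longrightarrow> (g has_real_derivative (\<kappa> - g x) / \<epsilon>) (at x)"
  shows "((\<lambda>x. f x * g x) has_integral \<kappa> * (u b - u a) - (\<sigma> b * g b - \<sigma> a * g a)) {a..b}"
proof -
  let ?H = "\<lambda>x. \<kappa> * u x - \<sigma> x * g x"
  have "((\<lambda>x. f x * g x) has_integral ?H b - ?H a) {a..b}"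
  proof (rule fundamental_theorem_of_calculus_interior[OF assms(2)])
    show "continuous_on {a..b} ?H" by (intro continuous_intros assms)
    fix x assume x: "x \<in> {a<..<b}"
    have "(?H has_real_derivative f x * g x) (at x)"
      using u[OF x] \<sigma>[OF x] g[OF x] assms(1)
      by (auto intro!: derivative_eq_intros simp: field_simps)
    then show "(?H has_vector_derivative f x * g x) (at x)"
      by (simp add: has_real_derivative_iff_has_vector_derivative)
  qed
  then show ?thesis by (simp add: algebra_simps)
qed

section \<open>The error recursion\<close>

text \<open>
  The recursion makes \<open>e i - e (i - 1)\<close> a positive multiple of \<open>e 1 - e 0\<close>, so that increments with
  sum zero must all be zero.
\<close>

lemma geometric_increments_vanish:
  fixes e :: "nat \<Rightarrow> real"
  assumes "r > 0" "e 0 = 0" "e n = 0"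
    and step: "\<And>j. j \<in> {1..n - 1} \<Longrightarrow> e (j + 1) - e j = r * (e j - e (j - 1))"
    and "i \<le> n"
  shows "e i = 0"
proof (cases "n = 0")
  case True
  then show ?thesis using assms by simp
next
  case False
  have incr: "e (Suc k) - e k = r ^ k * e 1" if "k < n" for k
    using that
  proof (induction k)
    case 0
    then show ?case using assms by simp
  next
    case (Suc k)
    then show ?case using step[of "Suc k"] by simp
  qed
  have partial: "e k = (\<Sum>l<k. r ^ l) * e 1" if "k \<le> n" for k
    using that
  proof (induction k)
    case 0
    then show ?case using assms by simp
  next
    case (Suc k)
    then show ?case using incr[of k] by (simp add: algebra_simps)
  qed
  have "(\<Sum>l<n. r ^ l) > 0" using False assms(1) by (intro sum_pos) auto
  then have "e 1 = 0" using partial[of n] assms(3) by auto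
  then show ?thesis using partial[OF assms(5)] by simp
qed

lemma sum_adjoint_flux:
  assumes "j \<in> {1..n - 1}"
  shows "(\<Sum>i = 1..n. adjoint_flux K j i * d i) = K * d j + (1 - K) * d (j + 1)"
proof -
  have "(\<Sum>i = 1..n. adjoint_flux K j i * d i) = (\<Sum>i\<in>{j, j + 1}. adjoint_flux K j i * d i)"
    using assms by (intro sum.mono_neutral_right) (auto simp: adjoint_flux_def)
  then show ?thesis by (simp add: adjoint_flux_def)
qed

section \<open>Nodal exactness\<close>

lemma petrov_galerkin_error_equation:
  assumes "\<epsilon> > 0" "n \<ge> 1" "continuous_on {0..1} f" "bvp_solution \<epsilon> 1 f 1 u"
    and w: "continuous_pw_linear n w"
    and g: "\<And>i. i \<in> {1..n} \<Longrightarrow> continuous_on {node n (i - 1)..node n i} g" "g 0 = 0" "g 1 = 0"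
    and ode: "\<And>i x. i \<in> {1..n} \<Longrightarrow> x \<in> {node n (i - 1)<..<node n i} \<Longrightarrow>
      (g has_real_derivative (\<kappa> i - g x) / \<epsilon>) (at x)"
    and weak: "\<epsilon> * integral {0..1} (\<lambda>x. deriv w x * deriv g x) + integral {0..1} (\<lambda>x. deriv w x * g x)
      = integral {0..1} (\<lambda>x. f x * g x)"
    and e: "\<And>i. e i = w (node n i) - u (node n i)"
  shows "(\<Sum>i = 1..n. \<kappa> i * (e i - e (i - 1))) = 0"
proof -
  obtain \<sigma> where \<sigma>: "continuous_on {0..1} \<sigma>"
    "\<And>x. x \<in> {0<..<1} \<Longrightarrow> (u has_real_derivative \<sigma> x / \<epsilon>) (at x)"
    "\<And>x. x \<in> {0<..<1} \<Longrightarrow> (\<sigma> has_real_derivative \<sigma> x / \<epsilon> - f x) (at x)"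
    using bvp_flux[OF assms(1) _ assms(3,4)] by auto
  have u: "continuous_on {0..1} u" using assms(4) by (simp add: bvp_solution_def)
  let ?x = "\<lambda>i. node n i"
  define D where "D = (\<lambda>i. integral {?x (i - 1)..?x i} (\<lambda>x. deriv w x * deriv g x))"
  define C where "C = (\<lambda>i. integral {?x (i - 1)..?x i} (\<lambda>x. deriv w x * g x))"
  have D: "((\<lambda>x. deriv w x * deriv g x) has_integral D i) {?x (i - 1)..?x i}"
    and C: "((\<lambda>x. deriv w x * g x) has_integral C i) {?x (i - 1)..?x i}"
    and DC: "\<epsilon> * D i + C i = \<kappa> i * (w (?x i) - w (?x (i - 1)))" if i: "i \<in> {1..n}" for i
  proof -
    have h: "?x i - ?x (i - 1) = mesh_width n" using node_step[of i n] i by simp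
    have "?x (i - 1) < ?x i" using i assms(2) by (intro node_less) auto
    moreover have "w y = w (?x (i - 1))
        + (w (?x i) - w (?x (i - 1))) * ((y - ?x (i - 1)) / (?x i - ?x (i - 1)))"
      if "y \<in> {?x (i - 1)..?x i}" for y
      unfolding h by (rule continuous_pw_linear_on_element[OF w i that])
    ultimately have "(\<lambda>x. deriv w x * deriv g x) integrable_on {?x (i - 1)..?x i}"
      "(\<lambda>x. deriv w x * g x) integrable_on {?x (i - 1)..?x i}"
      "\<epsilon> * D i + C i = \<kappa> i * (w (?x i) - w (?x (i - 1)))"
      unfolding D_def C_def
      using element_bilinear_form[OF assms(1) _ _ g(1)[OF i] ode[OF i], of w] by blast+
    then show "((\<lambda>x. deriv w x * deriv g x) has_integral D i) {?x (i - 1)..?x i}"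
      "((\<lambda>x. deriv w x * g x) has_integral C i) {?x (i - 1)..?x i}"
      "\<epsilon> * D i + C i = \<kappa> i * (w (?x i) - w (?x (i - 1)))"
      unfolding D_def C_def by (auto intro: integrable_integral)
  qed
  have load: "((\<lambda>x. f x * g x) has_integral \<kappa> i * (u (?x i) - u (?x (i - 1)))
      - (\<sigma> (?x i) * g (?x i) - \<sigma> (?x (i - 1)) * g (?x (i - 1)))) {?x (i - 1)..?x i}"
    if i: "i \<in> {1..n}" for i
  proof (rule element_load[OF assms(1) _ _ _ g(1)[OF i] _ _ ode[OF i]])
    show le: "?x (i - 1) \<le> ?x i" by (intro node_mono) auto
    show "continuous_on {?x (i - 1)..?x i} u" "continuous_on {?x (i - 1)..?x i} \<sigma>"
      using u \<sigma>(1) element_subset_unit[OF i] continuous_on_subset by blast+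
    fix y assume "y \<in> {?x (i - 1)<..<?x i}"
    then have "y \<in> {0<..<1}" using element_subset_unit[OF i] le by auto
    then show "(u has_real_derivative \<sigma> y / \<epsilon>) (at y)"
      "(\<sigma> has_real_derivative \<sigma> y / \<epsilon> - f y) (at y)" using \<sigma> by auto
  qed auto
  define W where "W = (\<Sum>i = 1..n. \<kappa> i * (w (?x i) - w (?x (i - 1))))"
  define U where "U = (\<Sum>i = 1..n. \<kappa> i * (u (?x i) - u (?x (i - 1))))"
  have boundary: "(\<Sum>i = 1..n. \<sigma> (?x i) * g (?x i) - \<sigma> (?x (i - 1)) * g (?x (i - 1))) = 0"
    unfolding One_nat_def sum_telescope''[OF le0, of "\<lambda>i. \<sigma> (?x i) * g (?x i)" n, unfolded One_nat_def]
      node_0 node_last[OF assms(2)] g(2,3) by simp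
  have "integral {0..1} (\<lambda>x. f x * g x) = U"
    using integral_unique[OF has_integral_sum_elements[OF assms(2) load]] boundary
    unfolding U_def by (simp only: sum_subtractf[of "\<lambda>i. \<kappa> i * (u (?x i) - u (?x (i - 1)))"] diff_zero)
  moreover have "\<epsilon> * integral {0..1} (\<lambda>x. deriv w x * deriv g x) + integral {0..1} (\<lambda>x. deriv w x * g x)
      = W"
  proof -
    have "\<epsilon> * (\<Sum>i = 1..n. D i) + (\<Sum>i = 1..n. C i) = (\<Sum>i = 1..n. \<epsilon> * D i + C i)"
      by (simp only: sum_distrib_left sum.distrib)
    also have "\<dots> = W" unfolding W_def by (intro sum.cong refl DC)
    finally show ?thesis
      using integral_unique[OF has_integral_sum_elements[OF assms(2) D]]
        integral_unique[OF has_integral_sum_elements[OF assms(2) C]] by simp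
  qed
  ultimately have "W - U = 0" using weak by simp
  moreover have "(\<Sum>i = 1..n. \<kappa> i * (e i - e (i - 1))) = W - U"
    unfolding W_def U_def sum_subtractf[symmetric] e by (intro sum.cong refl) (simp add: algebra_simps)
  ultimately show ?thesis by simp
qed

lemma hat_sum_at_node:
  assumes "\<forall>j\<in>{1..n - 1}. hat_function n j (\<phi> j)" "i \<le> n"
  shows "(\<Sum>j = 1..n - 1. c j * \<phi> j (node n i)) = (if i \<in> {1..n - 1} then c i else 0)"
proof -
  have "(\<Sum>j = 1..n - 1. c j * \<phi> j (node n i)) = (\<Sum>j = 1..n - 1. if i = j then c j else 0)"
    using assms by (intro sum.cong) (auto simp: hat_function_def)
  then show ?thesis by simp
qed

lemma in_fun_span:
  assumes "j \<in> {1..n - 1}"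
  shows "g j \<in> fun_span n g"
proof -
  have "(\<Sum>k = 1..n - 1. (if k = j then 1 else 0) * g k x) = g j x" for x
  proof -
    have "(\<Sum>k = 1..n - 1. (if k = j then 1 else 0) * g k x)
        = (\<Sum>k = 1..n - 1. if k = j then g k x else 0)"
      by (intro sum.cong) auto
    then show ?thesis using assms by simp
  qed
  then have "g j = (\<lambda>x. \<Sum>k = 1..n - 1. (if k = j then 1 else 0) * g k x)"
    by (intro ext) simp
  then show ?thesis
    unfolding fun_span_def by (intro CollectI exI[of _ "\<lambda>k. if k = j then 1 else 0"]) simp
qed

theorem theorem6p1:
  fixes \<epsilon> :: real and f u B u\<^sub>h I\<^sub>h_u :: "real \<Rightarrow> real"
    and n :: nat and \<phi> :: "nat \<Rightarrow> real \<Rightarrow> real" and c :: "nat \<Rightarrow> real"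
  assumes "\<epsilon> > 0"
    and "continuous_on {0..1} f"
    and "bvp_solution \<epsilon> 1 f 1 u"
    and "n \<ge> 2"
    and "\<forall>j\<in>{1..n - 1}. hat_function n j (\<phi> j)"
    and "exponential_bubble \<epsilon> (mesh_width n) B"
    and "pw_linear_interpolant n u I\<^sub>h_u"
    and "u\<^sub>h = (\<lambda>x. \<Sum>i = 1..n - 1. c i * \<phi> i x)"
    and "petrov_galerkin_solution \<epsilon> f (trial_space n \<phi>) (test_space n \<phi> B) u\<^sub>h"
  shows "(\<forall>x\<in>{0..1}. u\<^sub>h x = I\<^sub>h_u x) \<and> (\<forall>j\<in>{1..n - 1}. c j = u (node n j))"
proof -
  have n: "n \<ge> 1" using assms(4) by simp
  have B: "B 0 = 0" "B (mesh_width n) = 0"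
    using assms(6) by (auto simp: exponential_bubble_def bvp_solution_def)
  have u: "u 0 = 0" "u 1 = 0" using assms(3) by (auto simp: bvp_solution_def)
  have uh: "continuous_pw_linear n u\<^sub>h"
    unfolding assms(8) using assms(5) by (intro continuous_pw_linear_sum) (auto simp: hat_function_def)
  have nodal: "u\<^sub>h (node n i) = (if i \<in> {1..n - 1} then c i else 0)" if "i \<le> n" for i
    unfolding assms(8) using hat_sum_at_node[OF assms(5) that] .
  obtain K where K: "K > 1" and adj:
    "\<And>j i x. \<lbrakk>hat_function n j (\<phi> j); j \<ge> 1; i \<in> {1..n}; x \<in> {node n (i - 1)<..<node n i}\<rbrakk> \<Longrightarrow>
      (test_function n \<phi> B j has_real_derivative
        (adjoint_flux K j i - test_function n \<phi> B j x) / \<epsilon>) (at x)"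
    using test_function_adjoint_equation[OF assms(1,6) n, of \<phi>] by blast
  define e where "e = (\<lambda>i. u\<^sub>h (node n i) - u (node n i))"
  have step: "e (j + 1) - e j = K / (K - 1) * (e j - e (j - 1))" if j: "j \<in> {1..n - 1}" for j
  proof -
    let ?g = "test_function n \<phi> B j"
    have hat: "hat_function n j (\<phi> j)" "j \<ge> 1" using assms(5) j by auto
    have "?g \<in> test_space n \<phi> B" unfolding test_space_def by (rule in_fun_span[OF j])
    then have "\<epsilon> * integral {0..1} (\<lambda>x. deriv u\<^sub>h x * deriv ?g x) + integral {0..1} (\<lambda>x. deriv u\<^sub>h x * ?g x)
        = integral {0..1} (\<lambda>x. f x * ?g x)"
      using assms(9) unfolding petrov_galerkin_solution_def by blast
    then have "(\<Sum>i = 1..n. adjoint_flux K j i * (e i - e (i - 1))) = 0"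
      by (intro petrov_galerkin_error_equation[OF assms(1) n assms(2,3) uh, of ?g]
          test_function_continuous_on_element[where \<phi> = \<phi> and j = j, OF hat(1) assms(6) hat(2)]
          test_function_boundary[where \<phi> = \<phi> and j = j, OF hat(1) B j] adj[OF hat]) (auto simp: e_def)
    then have "K * (e j - e (j - 1)) + (1 - K) * (e (j + 1) - e j) = 0"
      using sum_adjoint_flux[OF j, of K "\<lambda>i. e i - e (i - 1)"] by simp
    then show ?thesis using K by (simp add: field_simps)
  qed
  have "e i = 0" if "i \<le> n" for i
  proof (rule geometric_increments_vanish[OF _ _ _ step that])
    show "K / (K - 1) > 0" using K by simp
    show "e 0 = 0" "e n = 0" using nodal[of 0] nodal[of n] u node_last[OF n] assms(4)
      by (auto simp: e_def node_0)
  qed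
  then have exact: "u\<^sub>h (node n i) = u (node n i)" if "i \<le> n" for i
    using that by (simp add: e_def)
  have "u\<^sub>h x = I\<^sub>h_u x" if "x \<in> {0..1}" for x
    using assms(7) exact
    by (intro continuous_pw_linear_eqI[OF n uh _ _ that]) (auto simp: pw_linear_interpolant_def)
  moreover have "c j = u (node n j)" if "j \<in> {1..n - 1}" for j
  proof -
    have "j \<le> n" using that by auto
    then show ?thesis using nodal[of j] exact[of j] that by simp
  qed
  ultimately show ?thesis by blast
qed

end
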